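(* For an irreducible fraction $\frac{r}{s}$, the polynomial $\mathcal{S}_{\frac{r}{s}}(q)$ is palindromic if and only if $r^2\equiv 1\pmod s$.
   Context: For an integer $c$, $[c]_q=\frac{1-q^c}{1-q}$. Every rational $\alpha>1$ has a unique negative continued fraction expansion $\alpha=c_1-\cfrac{1}{c_2-\cfrac{1}{\ddots-\cfrac{1}{c_l}}}$ with integers $c_j\ge 2$. Put $M^-_q(c)=\begin{pmatrix}[c]_q & -q^{c-1}\\ 1 & 0\end{pmatrix}$ and define $\mathcal{R}_\alpha(q),\mathcal{S}_\alpha(q)$ by $\begin{pmatrix}\mathcal{R}_\alpha(q)\\ \mathcal{S}_\alpha(q)\end{pmatrix}=M^-_q(c_1)\cdots M^-_q(c_l)\begin{pmatrix}1\\0\end{pmatrix}$. For rational $\alpha\le 1$ these are defined recursively by $\mathcal{S}_\alpha(q)=\mathcal{S}_{\alpha+1}(q)$ and $\mathcal{R}_\alpha(q)=q^{-1}(\mathcal{R}_{\alpha+1}(q)-\mathcal{S}_{\alpha+1}(q))$; $\mathcal{S}_\alpha(q)\in\mathbb Z[q]$ always. A polynomial $f(q)$ is palindromic if $f^\vee(q)=f(q)$, where $f^\vee(q)=q^{\deg f}f(q^{-1})$. An irreducible fraction $\frac{r}{s}$ means $\gcd(r,s)=1$, $s>0$. *)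

theory Defs
  imports
    "HOL-Analysis.Analysis"
    "HOL-Computational_Algebra.Computational_Algebra"
    "HOL-Number_Theory.Cong"
begin

text \<open>The indeterminate \<open>q\<close> is \<open>monom 1 1\<close>. Only entries \<open>c \<ge> 2\<close> occur below, so the
  \<open>q\<close>-integers are needed for natural numbers only; the division is exact in \<open>\<int>[q]\<close>.\<close>

definition q_int :: "nat \<Rightarrow> int poly" where
  "q_int c = (1 - monom 1 c) div (1 - monom 1 1)"

lemma q_int_mult: "q_int c * (1 - monom 1 1) = 1 - monom 1 c"
  and q_int_eq_sum: "q_int c = (\<Sum>i<c. monom 1 i)"
proof -
  have *: "(\<Sum>i<c. monom 1 i) * (1 - monom 1 1) = (1 - monom 1 c :: int poly)"
  proof (induction c)
    case 0
    show ?case by (simp add: monom_0 one_pCons)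
  next
    case (Suc c)
    have "monom 1 c * (1 - monom 1 1) = (monom 1 c - monom 1 (Suc c) :: int poly)"
      by (simp add: right_diff_distrib mult_monom)
    with Suc show ?case by (simp add: distrib_right)
  qed
  have nz: "1 - monom 1 1 \<noteq> (0 :: int poly)"
    by (simp add: poly_eq_iff) (rule exI[of _ 0], simp)
  show "q_int c = (\<Sum>i<c. monom 1 i)"
    unfolding q_int_def *[symmetric] using nz by simp
  then show "q_int c * (1 - monom 1 1) = 1 - monom 1 c"
    using * by simp
qed


fun neg_cf_value :: "nat list \<Rightarrow> rat" where
  "neg_cf_value [] = undefined"
| "neg_cf_value [c] = of_nat c"
| "neg_cf_value (c # d # cs) = of_nat c - 1 / neg_cf_value (d # cs)"

definition is_neg_cf :: "nat list \<Rightarrow> rat \<Rightarrow> bool" where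
  "is_neg_cf cs \<alpha> \<longleftrightarrow> cs \<noteq> [] \<and> (\<forall>c\<in>set cs. c \<ge> 2) \<and> neg_cf_value cs = \<alpha>"

lemma neg_cf_value_gt_1:
  assumes "cs \<noteq> []" "\<forall>c\<in>set cs. c \<ge> 2"
  shows "neg_cf_value cs > 1"
  using assms
proof (induction cs rule: neg_cf_value.induct)
  case (3 c d cs)
  then have "neg_cf_value (d # cs) > 1" by simp
  then have "1 / neg_cf_value (d # cs) < 1" by simp
  moreover have "(2::rat) \<le> of_nat c" using 3 by simp
  ultimately show ?case unfolding neg_cf_value.simps by linarith
qed auto

lemma neg_cf_value_inj:
  assumes "cs \<noteq> []" "\<forall>c\<in>set cs. c \<ge> 2" "ds \<noteq> []" "\<forall>c\<in>set ds. c \<ge> 2"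
    and "neg_cf_value cs = neg_cf_value ds"
  shows "cs = ds"
  using assms
proof (induction cs arbitrary: ds)
  case (Cons c cs)
  have head: "\<lceil>neg_cf_value (x # xs)\<rceil> = int x \<and> (xs = [] \<longleftrightarrow> neg_cf_value (x # xs) \<in> \<int>)"
    if "\<forall>c\<in>set (x # xs). c \<ge> 2" for x xs
  proof (cases xs)
    case (Cons y ys)
    define t where "t = 1 / neg_cf_value xs"
    have "neg_cf_value xs > 1" using neg_cf_value_gt_1[of xs] that Cons by simp
    then have t: "0 < t" "t < 1" by (simp_all add: t_def)
    have e: "neg_cf_value (x # xs) = of_nat x - t" using Cons by (simp add: t_def)
    have c: "\<lceil>of_nat x - t\<rceil> = int x" using t by (simp add: ceiling_eq_iff)
    have "of_nat x - t \<notin> \<int>"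
    proof
      assume "of_nat x - t \<in> \<int>"
      then have "of_nat x - t = of_int \<lceil>of_nat x - t\<rceil>" by (auto elim: Ints_cases)
      then show False using c t by simp
    qed
    then show ?thesis using e c Cons by simp
  qed simp
  obtain d ds' where ds: "ds = d # ds'" using Cons.prems by (cases ds) auto
  have hc: "\<lceil>neg_cf_value (c # cs)\<rceil> = int c" "cs = [] \<longleftrightarrow> neg_cf_value (c # cs) \<in> \<int>"
    using head[of c cs] Cons.prems by auto
  have hd: "\<lceil>neg_cf_value (d # ds')\<rceil> = int d" "ds' = [] \<longleftrightarrow> neg_cf_value (d # ds') \<in> \<int>"
    using head[of d ds'] Cons.prems ds by auto
  have "c = d" using hc hd Cons.prems ds by simp
  moreover have "cs = ds'"
  proof (cases cs)
    case Nil
    then show ?thesis using hc hd Cons.prems ds by simp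
  next
    case c': (Cons a as)
    then have "ds' \<noteq> []" using hc(2) hd(2) Cons.prems(5) ds by (metis list.distinct(1))
    then obtain b bs where b: "ds' = b # bs" by (cases ds') auto
    have "1 / neg_cf_value cs = 1 / neg_cf_value ds'"
      using Cons.prems(5) ds c' b \<open>c = d\<close> by simp
    then have "neg_cf_value cs = neg_cf_value ds'"
      by (metis inverse_eq_divide inverse_eq_imp_eq)
    then show ?thesis using Cons.IH[of ds'] Cons.prems ds c' b by simp
  qed
  ultimately show ?case using ds by simp
qed simp

lemma is_neg_cf_exists:
  fixes r s :: int
  assumes "0 < s" "s < r"
  shows "\<exists>cs. is_neg_cf cs (of_int r / of_int s)"
  using assms
proof (induction "nat s" arbitrary: r s rule: less_induct)
  case less
  show ?case
  proof (cases "s dvd r")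
    case True
    then obtain k where k: "r = s * k" by auto
    have "k > 1" using less.prems k by (simp add: zero_less_mult_iff)
    then have "k \<ge> 2" by simp
    then have "is_neg_cf [nat k] (of_int r / of_int s)"
      using less.prems k by (simp add: is_neg_cf_def)
    then show ?thesis ..
  next
    case False
    define c where "c = r div s + 1"
    define t where "t = c * s - r"
    have "r mod s \<noteq> 0" using False by (simp add: dvd_eq_mod_eq_0)
    moreover have "0 \<le> r mod s" and ms: "r mod s < s"
      using pos_mod_sign[OF less.prems(1)] pos_mod_bound[OF less.prems(1)] by blast+
    ultimately have m: "0 < r mod s" "r mod s < s" by linarith+
    have t': "t = s - r mod s"
      unfolding t_def c_def using mult_div_mod_eq[of s r] by (simp add: algebra_simps)
    have t: "0 < t" "t < s" using m t' by auto
    have "r div s \<ge> 1" using zdiv_mono1[of s r s] less.prems by simp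
    then have c2: "c \<ge> 2" by (simp add: c_def)
    obtain cs where cs: "is_neg_cf cs (of_int s / of_int t)"
      using less.hyps[of t s] t by auto
    then obtain d ds where d: "cs = d # ds" by (cases cs) (auto simp: is_neg_cf_def)
    have "(of_int r :: rat) = of_int c * of_int s - of_int t" by (simp add: t_def)
    then have "of_int c - of_int t / of_int s = (of_int r / of_int s :: rat)"
      using less.prems by (simp add: field_simps)
    moreover have "neg_cf_value cs = of_int s / of_int t"
      using cs by (simp add: is_neg_cf_def)
    ultimately have "neg_cf_value (nat c # cs) = of_int r / of_int s"
      using d c2 by simp
    then have "is_neg_cf (nat c # cs) (of_int r / of_int s)"
      using cs c2 by (auto simp: is_neg_cf_def)
    then show ?thesis ..
  qed
qed

lemma is_neg_cf_ex1:
  assumes "\<alpha> > 1"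
  shows "\<exists>!cs. is_neg_cf cs \<alpha>"
proof -
  obtain r s where q: "quotient_of \<alpha> = (r, s)" by fastforce
  have s: "s > 0" using quotient_of_denom_pos[OF q] .
  have e: "\<alpha> = of_int r / of_int s" using quotient_of_div[OF q] .
  have "s < r" using assms s e by simp
  then show ?thesis
    using is_neg_cf_exists[OF s] e neg_cf_value_inj unfolding is_neg_cf_def by blast
qed

definition neg_cf :: "rat \<Rightarrow> nat list" where
  "neg_cf \<alpha> = (THE cs. is_neg_cf cs \<alpha>)"

lemma is_neg_cf_neg_cf: "\<alpha> > 1 \<Longrightarrow> is_neg_cf (neg_cf \<alpha>) \<alpha>"
  unfolding neg_cf_def by (rule theI') (rule is_neg_cf_ex1)


definition M_minus :: "nat \<Rightarrow> int poly ^ 2 ^ 2" where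
  "M_minus c = vector [vector [q_int c, - monom 1 (c - 1)],
                       vector [1, 0]]"

definition RS_vec :: "nat list \<Rightarrow> int poly ^ 2" where
  "RS_vec cs = foldr (**) (map M_minus cs) (mat 1) *v vector [1, 0]"

function S_poly :: "rat \<Rightarrow> int poly" where
  "S_poly \<alpha> = (if \<alpha> > 1 then RS_vec (neg_cf \<alpha>) $ 2 else S_poly (\<alpha> + 1))"
  by auto
termination
  by (relation "Wellfounded.measure (\<lambda>\<alpha>::rat. nat (2 - \<lfloor>\<alpha>\<rfloor>))") auto

declare S_poly.simps [simp del]

text \<open>For \<open>\<alpha> \<le> 1\<close> the numerator may involve negative powers of \<open>q\<close>, hence a Laurent series.\<close>

function R_laurent :: "rat \<Rightarrow> int fls" where
  "R_laurent \<alpha> =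
     (if \<alpha> > 1 then fps_to_fls (fps_of_poly (RS_vec (neg_cf \<alpha>) $ 1))
      else fls_X_inv * (R_laurent (\<alpha> + 1) - fps_to_fls (fps_of_poly (S_poly (\<alpha> + 1)))))"
  by auto
termination
  by (relation "Wellfounded.measure (\<lambda>\<alpha>::rat. nat (2 - \<lfloor>\<alpha>\<rfloor>))") auto

declare R_laurent.simps [simp del]


text \<open>\<open>reflect_poly f\<close> is \<open>q\<^sup>d f(1/q)\<close> with \<open>d\<close> the degree of \<open>f\<close>.\<close>

definition palindromic :: "int poly \<Rightarrow> bool" where
  "palindromic f \<longleftrightarrow> reflect_poly f = f"

end

theory Submission
  imports Defs
begin

text \<open>
  Let \<open>K(c\<^sub>1, \<dots>, c\<^sub>n)\<close> be the upper left entry of \<open>M\<^sup>-\<^sub>q(c\<^sub>1) \<cdots> M\<^sup>-\<^sub>q(c\<^sub>n)\<close>. If \<open>r/s > 1\<close> has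
  expansion \<open>c\<^sub>0, c\<^sub>1, \<dots>, c\<^sub>n\<close>, then \<open>\<S>\<close> is \<open>K(c\<^sub>1, \<dots>, c\<^sub>n)\<close>, and reflecting this polynomial
  reverses the list. There is a symmetric matrix \<open>C\<close>, independent of \<open>c\<close>, with all
  \<open>M\<^sup>-\<^sub>q(c) C\<close> symmetric; so reversing a product \<open>P\<close> of such matrices amounts to the
  linear map \<open>P \<mapsto> C P\<^sup>T C\<^sup>-\<^sup>1\<close>. This yields
  \<open>K(c, x, d) - K(d, rev x, c) = q\<^bsup>d-1\<^esup> K(x) - q\<^bsup>c-1\<^esup> K(rev x)\<close> for every list \<open>x\<close>. As \<open>K\<close> has constant
  term \<open>1\<close>, vanishing of the right-hand side forces \<open>c = d\<close> and \<open>K(x) = K(rev x)\<close>, and by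
  induction \<open>K\<close> is palindromic only for palindromic lists. At \<open>q = 1\<close> the list has value
  \<open>s/t\<close> with \<open>t \<equiv> -r\<close>, and its reversal has value \<open>s/t'\<close> with \<open>t t' \<equiv> 1 (mod s)\<close>;
  hence the list is palindromic iff \<open>t\<^sup>2 \<equiv> 1\<close>.
\<close>

section \<open>Reversal of lists and the difference identity for continuants\<close>

unbundle no fps_syntax

text \<open>The entrywise form of the difference identity: \<open>n\<close>, \<open>m\<close> are
  the q-integers of the outer entries, and \<open>e\<close> relates the middle product to its
  reversal by the matrix C.\<close>

lemma continuant_entry_identity:
  fixes q :: "'a::idom"
  assumes n: "n * (1 - q) = 1 - q * w" and m: "m * (1 - q) = 1 - q * v"
    and e: "a' + (1 - q) * b' = a + (1 - q) * b"
      "(1 - q) * a' - q * b' = c + (1 - q) * d"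
      "c' + (1 - q) * d' = (1 - q) * a - q * b"
      "(1 - q) * c' - q * d' = (1 - q) * c - q * d"
    and nz: "1 - q \<noteq> 0" "1 - q + q * q \<noteq> 0"
  shows "(n * (m * a + b) - w * (m * c + d)) - (m * (n * a' + b') - v * (n * c' + d'))
    = v * a - w * a'"
proof -
  \<comment> \<open>\<open>D\<close> is minus the determinant of C and appears when \<open>e\<close>
    is solved for the primed entries; the factor (1 - q)^2 clears the denominators of
    \<open>n\<close> and \<open>m\<close>.\<close>
  define D where "D = 1 - q + q * q"
  have "D * ((1 - q) * (1 - q)) * ((n * (m * a + b) - w * (m * c + d))
      - (m * (n * a' + b') - v * (n * c' + d')) - (v * a - w * a')) = 0"
    unfolding D_def using n m e by algebra
  then show ?thesis using nz by (simp add: D_def)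
qed

text \<open>The product inside \<open>RS_vec\<close>, kept as a full matrix because reversal mixes
  all four entries.\<close>

definition neg_cf_mat :: "nat list \<Rightarrow> int poly ^ 2 ^ 2" where
  "neg_cf_mat cs = foldr (**) (map M_minus cs) (mat 1)"

abbreviation qcont :: "nat list \<Rightarrow> int poly" where
  "qcont cs \<equiv> neg_cf_mat cs $ 1 $ 1"

lemma M_minus_nth [simp]:
  "M_minus c $ 1 $ 1 = q_int c" "M_minus c $ 1 $ 2 = - monom 1 (c - 1)"
  "M_minus c $ 2 $ 1 = 1" "M_minus c $ 2 $ 2 = 0"
  by (simp_all add: M_minus_def)

lemma matrix_mult_2_nth: "(A ** B) $ i $ j = A $ i $ 1 * B $ 1 $ j + A $ i $ 2 * B $ 2 $ j"
  for A B :: "'a::semiring_1 ^ 2 ^ 2"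
  by (simp add: matrix_matrix_mult_def sum_2)

lemma neg_cf_mat_Nil: "neg_cf_mat [] = mat 1"
  by (simp add: neg_cf_mat_def)

lemma neg_cf_mat_Cons: "neg_cf_mat (c # cs) = M_minus c ** neg_cf_mat cs"
  by (simp add: neg_cf_mat_def)

lemma neg_cf_mat_append: "neg_cf_mat (cs @ ds) = neg_cf_mat cs ** neg_cf_mat ds"
  by (induction cs) (simp_all add: neg_cf_mat_Nil neg_cf_mat_Cons matrix_mul_assoc)

lemma neg_cf_mat_Nil_nth [simp]:
  "neg_cf_mat [] $ 1 $ 1 = 1" "neg_cf_mat [] $ 1 $ 2 = 0"
  "neg_cf_mat [] $ 2 $ 1 = 0" "neg_cf_mat [] $ 2 $ 2 = 1"
  by (simp_all add: neg_cf_mat_Nil mat_def)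

lemma neg_cf_mat_Cons_nth [simp]:
  "neg_cf_mat (c # cs) $ 1 $ j
     = q_int c * neg_cf_mat cs $ 1 $ j - monom 1 (c - 1) * neg_cf_mat cs $ 2 $ j"
  "neg_cf_mat (c # cs) $ 2 $ j = neg_cf_mat cs $ 1 $ j"
  by (simp_all add: neg_cf_mat_Cons matrix_mult_2_nth)

lemma neg_cf_mat_snoc_nth [simp]:
  "neg_cf_mat (cs @ [c]) $ i $ 1 = neg_cf_mat cs $ i $ 1 * q_int c + neg_cf_mat cs $ i $ 2"
  "neg_cf_mat (cs @ [c]) $ i $ 2 = - neg_cf_mat cs $ i $ 1 * monom 1 (c - 1)"
  by (simp_all add: neg_cf_mat_append matrix_mult_2_nth)

lemma q_int_mult_monom:
  assumes "c \<ge> 1"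
  shows "q_int c * (1 - monom 1 1) = 1 - monom 1 1 * monom 1 (c - 1)"
  using assms q_int_mult[of c] by (simp add: mult_monom)

text \<open>The matrix \<open>C\<close> of the introduction: up to a scalar, the only symmetric matrix for which
  \<open>M_minus c ** C\<close> is symmetric for every \<open>c\<close>.\<close>

definition rev_form :: "int poly ^ 2 ^ 2" where
  "rev_form = vector [vector [1, 1 - monom 1 1], vector [1 - monom 1 1, - monom 1 1]]"

lemma rev_form_nth [simp]:
  "rev_form $ 1 $ 1 = 1" "rev_form $ 1 $ 2 = 1 - monom 1 1"
  "rev_form $ 2 $ 1 = 1 - monom 1 1" "rev_form $ 2 $ 2 = - monom 1 1"
  by (simp_all add: rev_form_def)

lemma M_minus_rev_form:
  assumes "c \<ge> 1"
  shows "M_minus c ** rev_form = rev_form ** transpose (M_minus c)"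
  using q_int_mult_monom[OF assms]
  by (simp add: vec_eq_iff forall_2 matrix_mult_2_nth transpose_def) (simp add: algebra_simps)

lemma neg_cf_mat_rev:
  assumes "\<forall>c\<in>set cs. c \<ge> 1"
  shows "neg_cf_mat (rev cs) ** rev_form = rev_form ** transpose (neg_cf_mat cs)"
  using assms
proof (induction cs)
  case Nil
  show ?case by (simp add: neg_cf_mat_Nil transpose_mat)
next
  case (Cons c cs)
  have "neg_cf_mat (rev (c # cs)) ** rev_form = neg_cf_mat (rev cs) ** (M_minus c ** rev_form)"
    by (simp add: neg_cf_mat_append neg_cf_mat_Cons neg_cf_mat_Nil matrix_mul_assoc)
  also have "\<dots> = (neg_cf_mat (rev cs) ** rev_form) ** transpose (M_minus c)"
    using Cons.prems by (simp add: M_minus_rev_form matrix_mul_assoc)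
  also have "\<dots> = rev_form ** transpose (neg_cf_mat (c # cs))"
    using Cons by (simp add: neg_cf_mat_Cons matrix_transpose_mul matrix_mul_assoc)
  finally show ?case .
qed

lemma neg_cf_mat_rev_nth:
  fixes cs and P Q :: "int poly ^ 2 ^ 2" and q :: "int poly"
  defines "P \<equiv> neg_cf_mat cs" and "Q \<equiv> neg_cf_mat (rev cs)" and "q \<equiv> monom 1 1"
  assumes "\<forall>c\<in>set cs. c \<ge> 1"
  shows "Q $ 1 $ 1 + (1 - q) * Q $ 1 $ 2 = P $ 1 $ 1 + (1 - q) * P $ 1 $ 2"
    and "(1 - q) * Q $ 1 $ 1 - q * Q $ 1 $ 2 = P $ 2 $ 1 + (1 - q) * P $ 2 $ 2"
    and "Q $ 2 $ 1 + (1 - q) * Q $ 2 $ 2 = (1 - q) * P $ 1 $ 1 - q * P $ 1 $ 2"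
    and "(1 - q) * Q $ 2 $ 1 - q * Q $ 2 $ 2 = (1 - q) * P $ 2 $ 1 - q * P $ 2 $ 2"
proof -
  have "(Q ** rev_form) $ i $ j = (rev_form ** transpose P) $ i $ j" for i j
    using neg_cf_mat_rev[OF assms(4)] by (simp add: P_def Q_def)
  from this[of 1 1] this[of 1 2] this[of 2 1] this[of 2 2]
  show "Q $ 1 $ 1 + (1 - q) * Q $ 1 $ 2 = P $ 1 $ 1 + (1 - q) * P $ 1 $ 2"
    and "(1 - q) * Q $ 1 $ 1 - q * Q $ 1 $ 2 = P $ 2 $ 1 + (1 - q) * P $ 2 $ 2"
    and "Q $ 2 $ 1 + (1 - q) * Q $ 2 $ 2 = (1 - q) * P $ 1 $ 1 - q * P $ 1 $ 2"
    and "(1 - q) * Q $ 2 $ 1 - q * Q $ 2 $ 2 = (1 - q) * P $ 2 $ 1 - q * P $ 2 $ 2"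
    by (simp_all add: matrix_mult_2_nth transpose_def q_def mult.commute)
qed

lemma qcont_diff_qcont_rev:
  assumes "c \<ge> 1" "d \<ge> 1" "\<forall>x\<in>set xs. x \<ge> 1"
  shows "qcont (c # xs @ [d]) - qcont (d # rev xs @ [c])
    = monom 1 (d - 1) * qcont xs - monom 1 (c - 1) * qcont (rev xs)"
proof -
  let ?q = "monom 1 1 :: int poly"
  have "poly (1 - ?q) 0 \<noteq> 0" "poly (1 - ?q + ?q * ?q) 0 \<noteq> 0"
    by (simp_all add: poly_monom)
  then have "1 - ?q \<noteq> 0" "1 - ?q + ?q * ?q \<noteq> 0"
    by (metis poly_0)+
  from continuant_entry_identity[OF q_int_mult_monom[OF assms(1)] q_int_mult_monom[OF assms(2)]
      neg_cf_mat_rev_nth[OF assms(3)] this]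
  show ?thesis by (simp add: algebra_simps)
qed

text \<open>For c \<ge> 2 the term \<open>monom 1 (c - 1)\<close> vanishes at q = 0, where
  \<open>q_int c\<close> is 1, so the recursion preserves the constant term.\<close>

lemma coeff_0_qcont:
  assumes "\<forall>c\<in>set cs. c \<ge> 2"
  shows "coeff (qcont cs) 0 = 1"
  using assms
proof (induction cs)
  case (Cons c cs)
  have "coeff (q_int c) 0 = 1"
    using Cons.prems by (simp add: q_int_eq_sum coeff_sum)
  then show ?case using Cons by (simp add: coeff_mult)
qed simp

lemma qcont_rev_eq_iff:
  assumes "\<forall>c\<in>set cs. c \<ge> 2"
  shows "qcont (rev cs) = qcont cs \<longleftrightarrow> rev cs = cs"
  using assms
proof (induction "length cs" arbitrary: cs rule: less_induct)
  case less
  show ?case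
  proof (cases "length cs < 2")
    case True
    then have "rev cs = cs" by (cases cs) auto
    then show ?thesis by simp
  next
    case False
    then obtain c ys where "cs = c # ys" "ys \<noteq> []" by (cases cs) auto
    then obtain xs d where cs: "cs = c # xs @ [d]" by (metis rev_exhaust)
    have ge: "c \<ge> 2" "d \<ge> 2" "\<forall>x\<in>set xs. x \<ge> 2" using less.prems cs by auto
    have diff: "qcont cs - qcont (rev cs)
        = monom 1 (d - 1) * qcont xs - monom 1 (c - 1) * qcont (rev xs)"
      using qcont_diff_qcont_rev[of c d xs] ge cs by fastforce
    have IH: "qcont (rev xs) = qcont xs \<longleftrightarrow> rev xs = xs"
      using less.hyps[of xs] cs ge by simp
    show ?thesis
    proof
      assume "qcont (rev cs) = qcont cs"
      then have eq: "monom 1 (d - 1) * qcont xs = monom 1 (c - 1) * qcont (rev xs)"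
        using diff by simp
      have k: "coeff (qcont xs) 0 = 1" "coeff (qcont (rev xs)) 0 = 1"
        using coeff_0_qcont ge by auto
      have "coeff (monom 1 (d - 1) * qcont xs) i = coeff (monom 1 (c - 1) * qcont (rev xs)) i" for i
        using eq by simp
      \<comment> \<open>At index \<open>c - 1\<close> the right side has coefficient 1, while the
        left side vanishes below \<open>d - 1\<close>; index \<open>d - 1\<close> gives the opposite
        inequality.\<close>
      from this[of "c - 1"] this[of "d - 1"] have "c - 1 = d - 1"
        using k by (auto simp: coeff_monom_mult split: if_splits)
      then have "c = d" using ge by simp
      then show "rev cs = cs" using eq IH cs by simp
    qed simp
  qed
qed


section \<open>Reflection of continuants\<close>

text \<open>Reflecting about a fixed bound \<open>N\<close> is additive, unlike
  \<open>reflect_poly\<close>, so it can be applied termwise to the continuant recursion.\<close>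

definition reflect_upto :: "nat \<Rightarrow> 'a::comm_semiring_1 poly \<Rightarrow> 'a poly" where
  "reflect_upto N p = monom 1 (N - degree p) * reflect_poly p"

lemma coeff_reflect_upto:
  assumes "degree p \<le> N"
  shows "coeff (reflect_upto N p) i = (if i \<le> N then coeff p (N - i) else 0)"
  using assms
  by (auto simp: reflect_upto_def coeff_monom_mult coeff_reflect_poly coeff_eq_0 not_less
      intro!: arg_cong[of _ _ "coeff p"])

lemma reflect_upto_diff:
  fixes p r :: "'a::comm_ring_1 poly"
  assumes "degree p \<le> N" "degree r \<le> N"
  shows "reflect_upto N (p - r) = reflect_upto N p - reflect_upto N r"
  using assms by (auto simp: poly_eq_iff coeff_reflect_upto degree_diff_le)

lemma reflect_upto_mult:
  fixes p r :: "'a::idom poly"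
  assumes "degree p \<le> M" "degree r \<le> N"
  shows "reflect_upto (M + N) (p * r) = reflect_upto M p * reflect_upto N r"
proof (cases "p = 0 \<or> r = 0")
  case False
  then have "M + N - degree (p * r) = (M - degree p) + (N - degree r)"
    using assms by (simp add: degree_mult_eq)
  then have "monom 1 (M + N - degree (p * r))
      = (monom 1 (M - degree p) * monom 1 (N - degree r) :: 'a poly)"
    by (simp add: mult_monom)
  then show ?thesis by (simp add: reflect_upto_def reflect_poly_mult mult_ac)
qed (auto simp: reflect_upto_def)

lemma reflect_upto_monom:
  assumes "k \<le> N"
  shows "reflect_upto N (monom 1 k) = monom 1 (N - k)"
  using assms by (auto simp: poly_eq_iff coeff_reflect_upto degree_monom_eq)

lemma coeff_q_int: "coeff (q_int c) i = (if i < c then 1 else 0)"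
  by (simp add: q_int_eq_sum coeff_sum)

lemma degree_q_int_le: "degree (q_int c) \<le> c - 1"
  by (rule degree_le) (auto simp: coeff_q_int)

lemma reflect_upto_q_int:
  assumes "c \<ge> 1"
  shows "reflect_upto (c - 1) (q_int c) = q_int c"
  using assms coeff_reflect_upto[OF degree_q_int_le, of c] by (auto simp: poly_eq_iff coeff_q_int)

lemma qcont_rev_eq_reflect_upto:
  assumes "\<forall>c\<in>set cs. c \<ge> 1"
  shows "degree (qcont cs) \<le> (\<Sum>c\<leftarrow>cs. c - 1)
    \<and> qcont (rev cs) = reflect_upto (\<Sum>c\<leftarrow>cs. c - 1) (qcont cs)"
  using assms
proof (induction cs rule: induct_list012)
  case 1
  show ?case by (simp add: reflect_upto_def)
next
  case (2 c)
  have "qcont [c] = q_int c" by simp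
  then show ?case using degree_q_int_le reflect_upto_q_int[of c] 2 by simp
next
  case (3 c d cs)
  define N where "N = (\<Sum>c\<leftarrow>cs. c - 1)"
  define N' where "N' = (\<Sum>c\<leftarrow>d # cs. c - 1)"
  have N': "N' = (d - 1) + N" and sum: "(\<Sum>c\<leftarrow>c # d # cs. c - 1) = (c - 1) + N'"
    by (simp_all add: N_def N'_def)
  have rec: "qcont (c # d # cs) = q_int c * qcont (d # cs) - monom 1 (c - 1) * qcont cs"
    by simp
  have rec': "qcont (rev (c # d # cs))
      = q_int c * qcont (rev (d # cs)) - monom 1 (d - 1) * qcont (rev cs)"
    by (simp add: mult.commute flip: append_assoc)
  have IH: "degree (qcont cs) \<le> N" "qcont (rev cs) = reflect_upto N (qcont cs)"
    "degree (qcont (d # cs)) \<le> N'" "qcont (rev (d # cs)) = reflect_upto N' (qcont (d # cs))"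
    using 3 unfolding N_def N'_def by auto
  \<comment> \<open>The bound is deliberately larger than the degree: about (c - 1) + (d - 1), the
    monomial of \<open>c\<close> reflects to that of \<open>d\<close>, as \<open>rec'\<close>
    requires.\<close>
  have m: "degree (monom 1 (c - 1) :: int poly) \<le> (c - 1) + (d - 1)"
    by (simp add: degree_monom_eq)
  have deg: "degree (q_int c * qcont (d # cs)) \<le> (c - 1) + N'"
    by (rule order.trans[OF degree_mult_le add_mono[OF degree_q_int_le IH(3)]])
  have deg': "degree (monom 1 (c - 1) * qcont cs) \<le> (c - 1) + N'"
    using order.trans[OF degree_mult_le add_mono[OF m IH(1)]] by (simp add: N')
  have "reflect_upto ((c - 1) + N') (q_int c * qcont (d # cs)) = q_int c * qcont (rev (d # cs))"
    using reflect_upto_mult[OF degree_q_int_le IH(3), of c] reflect_upto_q_int[of c] 3 IH(4) by simp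
  moreover have "reflect_upto ((c - 1) + N') (monom 1 (c - 1) * qcont cs)
      = monom 1 (d - 1) * qcont (rev cs)"
    using reflect_upto_mult[OF m IH(1)] IH(2)
    by (simp add: reflect_upto_monom N' add.assoc)
  ultimately show ?case
    unfolding sum rec rec' using deg deg' by (simp add: reflect_upto_diff degree_diff_le)
qed

lemma reflect_poly_qcont:
  assumes "\<forall>c\<in>set cs. c \<ge> 2"
  shows "reflect_poly (qcont cs) = qcont (rev cs)"
proof -
  define N where "N = (\<Sum>c\<leftarrow>cs. c - 1)"
  have N: "degree (qcont cs) \<le> N" "qcont (rev cs) = reflect_upto N (qcont cs)"
    using qcont_rev_eq_reflect_upto[of cs] assms unfolding N_def by force+
  have "coeff (qcont (rev cs)) 0 = 1"
    using coeff_0_qcont[of "rev cs"] assms by simp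
  \<comment> \<open>The constant term of the reversed continuant is the coefficient at
    \<open>N\<close>, so the bound \<open>N\<close> is the exact degree.\<close>
  then have "coeff (qcont cs) N = 1"
    using N by (simp add: coeff_reflect_upto)
  then have "degree (qcont cs) = N"
    using N(1) le_degree[of "qcont cs" N] by simp
  then show ?thesis using N(2) by (simp add: reflect_upto_def)
qed

lemma palindromic_qcont_iff:
  assumes "\<forall>c\<in>set cs. c \<ge> 2"
  shows "palindromic (qcont cs) \<longleftrightarrow> rev cs = cs"
  using reflect_poly_qcont[OF assms] qcont_rev_eq_iff[OF assms] by (simp add: palindromic_def)

section \<open>Specialisation at q = 1\<close>

lemma poly_q_int_1: "poly (q_int c) 1 = int c"
  by (simp add: q_int_eq_sum poly_sum poly_monom)

lemma neg_cf_mat_det_1: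
  "poly (neg_cf_mat cs $ 1 $ 1) 1 * poly (neg_cf_mat cs $ 2 $ 2) 1
    - poly (neg_cf_mat cs $ 1 $ 2) 1 * poly (neg_cf_mat cs $ 2 $ 1) 1 = 1"
  by (induction cs) (simp_all add: poly_monom algebra_simps)

text \<open>At q = 1 the matrix \<open>rev_form\<close> becomes diag(1, -1), so reversal is
  transposition with a sign change off the diagonal.\<close>

lemma neg_cf_mat_rev_1:
  assumes "\<forall>c\<in>set cs. c \<ge> 1"
  shows "poly (neg_cf_mat (rev cs) $ 1 $ 1) 1 = poly (neg_cf_mat cs $ 1 $ 1) 1"
    and "poly (neg_cf_mat (rev cs) $ 2 $ 1) 1 = - poly (neg_cf_mat cs $ 1 $ 2) 1"
  using neg_cf_mat_rev_nth(1,3)[OF assms, THEN arg_cong, of "\<lambda>p. poly p 1"]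
  by (simp_all add: poly_monom)

text \<open>The bounds on \<open>t\<close> drive the induction and later make \<open>t\<close>
  determined by its residue modulo \<open>s\<close>.\<close>

lemma neg_cf_value_eq:
  assumes "cs \<noteq> []" "\<forall>c\<in>set cs. c \<ge> 2"
  defines "s \<equiv> poly (neg_cf_mat cs $ 1 $ 1) 1" and "t \<equiv> poly (neg_cf_mat cs $ 2 $ 1) 1"
  shows "0 < t \<and> t < s \<and> neg_cf_value cs = of_int s / of_int t"
  using assms(1,2) unfolding s_def t_def
proof (induction cs rule: neg_cf_value.induct)
  case (2 c)
  then show ?case by (simp add: poly_q_int_1)
next
  case (3 c d cs)
  define s where "s = poly (neg_cf_mat (d # cs) $ 1 $ 1) 1"
  define t where "t = poly (neg_cf_mat (d # cs) $ 2 $ 1) 1"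
  have IH: "0 < t" "t < s" "neg_cf_value (d # cs) = of_int s / of_int t"
    using 3 unfolding s_def t_def by auto
  have e: "poly (neg_cf_mat (c # d # cs) $ 1 $ 1) 1 = int c * s - t"
    "poly (neg_cf_mat (c # d # cs) $ 2 $ 1) 1 = s"
    by (simp_all only: s_def t_def neg_cf_mat_Cons_nth(1)[of c] neg_cf_mat_Cons_nth(2)[of c])
       (simp add: poly_q_int_1 poly_monom)
  have "2 * s \<le> int c * s" using 3 IH by (intro mult_right_mono) auto
  then have "s < int c * s - t" using IH by linarith
  moreover have "neg_cf_value (c # d # cs) = of_int (int c * s - t) / of_int s"
    using IH by (simp add: diff_divide_distrib)
  ultimately show ?case unfolding e using IH by simp
qed simp

lemma rev_eq_iff_square_cong:
  assumes "cs \<noteq> []" "\<forall>c\<in>set cs. c \<ge> 2"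
  defines "s \<equiv> poly (neg_cf_mat cs $ 1 $ 1) 1" and "t \<equiv> poly (neg_cf_mat cs $ 2 $ 1) 1"
  shows "rev cs = cs \<longleftrightarrow> [t\<^sup>2 = 1] (mod s)"
proof -
  define t' where "t' = poly (neg_cf_mat (rev cs) $ 2 $ 1) 1"
  have ge1: "\<forall>c\<in>set cs. c \<ge> 1" using assms(2) by force
  have s': "poly (neg_cf_mat (rev cs) $ 1 $ 1) 1 = s"
    using neg_cf_mat_rev_1[OF ge1] by (simp add: s_def)
  have t: "0 < t" "t < s" "neg_cf_value cs = of_int s / of_int t"
    using neg_cf_value_eq[OF assms(1,2)] by (auto simp: s_def t_def)
  have t': "0 < t'" "t' < s" "neg_cf_value (rev cs) = of_int s / of_int t'"
    using neg_cf_value_eq[of "rev cs"] assms(1,2) s' by (auto simp: t'_def)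
  \<comment> \<open>The determinant is 1 and the upper right entry is \<open>- t'\<close>.\<close>
  have "t * t' - 1 = - s * poly (neg_cf_mat cs $ 2 $ 2) 1"
    using neg_cf_mat_det_1[of cs] neg_cf_mat_rev_1(2)[OF ge1]
    by (simp add: s_def t_def t'_def algebra_simps)
  then have inv: "[t * t' = 1] (mod s)"
    by (simp add: cong_iff_dvd_diff)
  show ?thesis
  proof
    assume "rev cs = cs"
    then show "[t\<^sup>2 = 1] (mod s)" using inv by (simp add: t_def t'_def power2_eq_square)
  next
    assume "[t\<^sup>2 = 1] (mod s)"
    then have "[t * t = t * t'] (mod s)"
      using inv by (metis cong_sym cong_trans power2_eq_square)
    moreover have "coprime t s" using inv coprime_iff_invertible_int by blast
    ultimately have "[t = t'] (mod s)" by (simp add: cong_mult_lcancel)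
    \<comment> \<open>Both numbers lie strictly between 0 and \<open>s\<close>.\<close>
    then have "t = t'" using t t' by (simp add: cong_def)
    then have "neg_cf_value (rev cs) = neg_cf_value cs" using t t' by simp
    then show "rev cs = cs" using assms neg_cf_value_inj[of "rev cs" cs] by simp
  qed
qed

section \<open>From expansions to fractions\<close>

lemma palindromic_S_poly_gt_1:
  fixes r s :: int
  assumes "coprime r s" "s > 0" "s < r"
  shows "palindromic (S_poly (of_int r / of_int s)) \<longleftrightarrow> [r\<^sup>2 = 1] (mod s)"
proof -
  define \<alpha> :: rat where "\<alpha> = of_int r / of_int s"
  have "\<alpha> > 1" using assms by (simp add: \<alpha>_def)
  then obtain c cs where cf: "neg_cf \<alpha> = c # cs" and val: "neg_cf_value (c # cs) = \<alpha>"
    and ge: "\<forall>x\<in>set (c # cs). x \<ge> 2"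
    using is_neg_cf_neg_cf[of \<alpha>] unfolding is_neg_cf_def by (metis list.exhaust)
  have "RS_vec (c # cs) $ 2 = neg_cf_mat (c # cs) $ 2 $ 1"
    by (simp only: RS_vec_def flip: neg_cf_mat_def) (simp add: matrix_vector_mult_def sum_2)
  \<comment> \<open>The second row of \<open>M_minus c\<close> is (1, 0), so the leading entry drops
    out.\<close>
  then have S: "S_poly \<alpha> = qcont cs"
    using \<open>\<alpha> > 1\<close> cf by (simp add: S_poly.simps[of \<alpha>])
  define s' where "s' = poly (neg_cf_mat (c # cs) $ 2 $ 1) 1"
  define r' where "r' = poly (neg_cf_mat (c # cs) $ 1 $ 1) 1"
  have r': "0 < s'" "0 < r'" "of_int r / of_int s = (of_int r' / of_int s' :: rat)"
    using neg_cf_value_eq[of "c # cs"] ge val unfolding s'_def r'_def \<alpha>_def by force+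
  \<comment> \<open>By the determinant, r'/s' is in lowest terms, hence it is r/s itself.\<close>
  have "poly (neg_cf_mat (c # cs) $ 1 $ 2) 1 * s' + 1 = r' * poly (neg_cf_mat (c # cs) $ 2 $ 2) 1"
    using neg_cf_mat_det_1[of "c # cs"] by (simp add: s'_def r'_def)
  then have "coprime r' s'"
    by (metis coprime_1_left coprime_add_one_left coprime_commute
        coprime_mult_left_iff coprime_mult_right_iff)
  have "of_int (r * s') = (of_int (r' * s) :: rat)" using r' assms by (simp add: field_simps)
  then have "r * s' = r' * s" by (simp only: of_int_eq_iff)
  then have eq: "r = r'" "s = s'"
    using assms \<open>coprime r' s'\<close> r'(1,2) coprime_crossproduct_int[of r s r' s']
    by (simp_all add: coprime_commute)
  show ?thesis
  proof (cases "cs = []")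
    case True
    \<comment> \<open>Integers are separate because \<open>neg_cf_value []\<close> is undefined;
      here both sides hold trivially.\<close>
    then have "s = 1" using eq by (simp add: s'_def)
    then show ?thesis using S True by (simp add: \<alpha>_def palindromic_def)
  next
    case False
    define t where "t = poly (neg_cf_mat cs $ 2 $ 1) 1"
    have s: "s = poly (qcont cs) 1" using eq by (simp add: s'_def)
    have "r = int c * s - t"
      using eq s by (simp add: r'_def t_def poly_q_int_1 poly_monom)
    then have "(r + t) * (r - t) = s * (int c * (r - t))" by simp
    then have "r\<^sup>2 - t\<^sup>2 = s * (int c * (r - t))"
      by (simp add: power2_eq_square square_diff_square_factored)
    then have "[r\<^sup>2 = t\<^sup>2] (mod s)" by (simp add: cong_iff_dvd_diff)
    then have "[r\<^sup>2 = 1] (mod s) \<longleftrightarrow> [t\<^sup>2 = 1] (mod s)"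
      by (meson cong_sym cong_trans)
    then show ?thesis
      using S s palindromic_qcont_iff[of cs] rev_eq_iff_square_cong[of cs] False ge
      by (simp add: \<alpha>_def t_def)
  qed
qed

theorem theorem3p6:
  fixes r s :: int
  assumes "coprime r s" and "s > 0"
  shows "palindromic (S_poly (of_int r / of_int s)) \<longleftrightarrow> [r\<^sup>2 = 1] (mod s)"
  using assms
\<comment> \<open>The recursion of \<open>S_poly\<close> replaces r by r + s, which keeps r^2 modulo
  s and lowers this measure while r \<le> s.\<close>
proof (induction "nat (s + 1 - r)" arbitrary: r rule: less_induct)
  case less
  show ?case
  proof (cases "s < r")
    case True
    then show ?thesis using palindromic_S_poly_gt_1 less.prems by blast
  next
    case False
    then have "\<not> (of_int r / of_int s > (1 :: rat))" using less.prems by simp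
    moreover have "of_int r / of_int s + 1 = (of_int (r + s) / of_int s :: rat)"
      using less.prems by (simp add: field_simps)
    ultimately have "S_poly (of_int r / of_int s) = S_poly (of_int (r + s) / of_int s)"
      by (simp add: S_poly.simps[of "of_int r / of_int s"])
    moreover have "coprime (r + s) s"
      using less.prems by (simp add: coprime_iff_gcd_eq_1)
    moreover have "[(r + s)\<^sup>2 = r\<^sup>2] (mod s)"
      by (simp add: cong_iff_dvd_diff power2_eq_square algebra_simps)
    moreover have "nat (s + 1 - (r + s)) < nat (s + 1 - r)" using False less.prems by simp
    ultimately show ?thesis
      using less.hyps[of "r + s"] less.prems by (metis cong_sym cong_trans)
  qed
qed

end
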